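(* If $R$ is an infinite Boolean ring, then $|R|\leqslant|\operatorname{Spec}(R)|$.
   Context: A Boolean ring is a (commutative, unital) ring in which every element is idempotent. $|X|$ denotes the cardinality of a set $X$. *)

theory Defs
  imports "HOL-Algebra.Algebra" "HOL-Library.Equipollence"
begin

locale boolean_ring = cring +
  assumes idem: "x \<in> carrier R \<Longrightarrow> x \<otimes> x = x"

definition Spec :: "('a, 'b) ring_scheme \<Rightarrow> 'a set set" where
  "Spec R = {P. primeideal P R}"

end

theory Submission
  imports Defs
begin

text \<open>
  Pick, for every pair of distinct prime ideals, one element lying in exactly one of them. The
  subring \<open>S\<close> generated by these elements separates prime ideals and has cardinality at most that
  of the (infinite) spectrum. It is all of \<open>R\<close>: for an element \<open>a\<close> outside \<open>S\<close> there are two prime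
  ideals with the same trace on \<open>S\<close> of which only one contains \<open>a\<close>. Indeed, take a prime \<open>P\<close>
  containing no \<open>s \<in> S\<close> with \<open>(1 - s) a \<in> S\<close>; then neither \<open>a\<close> nor \<open>1 - a\<close> is annihilated by an
  element of \<open>S - P\<close>, so each of them can be kept outside a prime with the same trace on \<open>S\<close> as \<open>P\<close>.
\<close>

text \<open>Both \<^const>\<open>iso_incl\<close> and \<^const>\<open>lepoll\<close> are written \<open>\<lesssim>\<close>.\<close>

no_notation iso_incl (infixl \<open>\<lesssim>\<close> 65)

section \<open>Cardinality of the subring generated by a set\<close>

lemma UN_lepoll_infinite:
  assumes "infinite Y" "I \<lesssim> Y" "\<And>i. i \<in> I \<Longrightarrow> A i \<lesssim> Y"
  shows "(\<Union>i\<in>I. A i) \<lesssim> Y"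
  using card_of_UNION_ordLeq_infinite[of Y I A] assms
  unfolding lepoll_def card_of_ordLeq by blast

lemma Times_lepoll_infinite:
  assumes "infinite Y" "A \<lesssim> Y" "B \<lesssim> Y"
  shows "A \<times> B \<lesssim> Y"
proof -
  have "Y \<times> Y \<approx> Y"
    using card_of_Times_same_infinite[OF assms(1)] by (simp add: eqpoll_iff_card_of_ordIso)
  with times_lepoll_mono[OF assms(2,3)] show ?thesis
    by (rule lepoll_trans2)
qed

text \<open>The generated ring is covered by countably many stages, each obtained by applying
  finitely many operations to pairs from the previous one; neither such a step nor the countable
  union exceeds the infinite cardinality of \<open>Y\<close>.\<close>

lemma generate_ring_lepoll:
  fixes R (structure)
  assumes Y: "infinite Y" and H: "H \<lesssim> Y"
  shows "generate_ring R H \<lesssim> Y"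
proof -
  \<comment> \<open>Negation gets a dummy second argument so that all operations are binary; the
    projection makes the stages \<open>G n\<close> increase.\<close>
  define ops where "ops = {(\<lambda>x y. x), (\<lambda>x y. \<ominus> x), (\<lambda>x y. x \<oplus> y), (\<lambda>x y. x \<otimes> y)}"
  define G where "G = rec_nat (insert \<one> H) (\<lambda>_ K. \<Union>f\<in>ops. (\<lambda>(x, y). f x y) ` (K \<times> K))"
  have G_0: "G 0 = insert \<one> H"
    and G_Suc: "G (Suc n) = (\<Union>f\<in>ops. (\<lambda>(x, y). f x y) ` (G n \<times> G n))" for n
    by (simp_all add: G_def)
  have ops: "f x y \<in> G (Suc n)" if "f \<in> ops" "x \<in> G n" "y \<in> G n" for f x y n
    using that unfolding G_Suc by force
  have "G n \<subseteq> G (Suc n)" for n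
    using ops[of "\<lambda>x y. x"] by (auto simp: ops_def)
  then have mono: "G m \<subseteq> G n" if "m \<le> n" for m n
    using lift_Suc_mono_le[of G] that by blast
  have closed: "\<exists>n. f x y \<in> G n" if "f \<in> ops" "x \<in> G k" "y \<in> G l" for f x y k l
    using ops[OF that(1), of x "max k l" y] mono[of k "max k l"] mono[of l "max k l"] that by auto
  have "generate_ring R H \<subseteq> (\<Union>n. G n)"
  proof
    fix x assume "x \<in> generate_ring R H"
    then show "x \<in> (\<Union>n. G n)"
    proof (induction rule: generate_ring.induct)
      case one
      show ?case using G_0 by blast
    next
      case (incl h)
      then show ?case using G_0 by blast
    next
      case (a_inv h)
      then show ?case using closed[of "\<lambda>x y. \<ominus> x" h _ h] by (auto simp: ops_def)
    next
      case (eng_add h1 h2)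
      then show ?case using closed[of "\<lambda>x y. x \<oplus> y" h1 _ h2] by (auto simp: ops_def)
    next
      case (eng_mult h1 h2)
      then show ?case using closed[of "\<lambda>x y. x \<otimes> y" h1 _ h2] by (auto simp: ops_def)
    qed
  qed
  moreover have "G n \<lesssim> Y" for n
  proof (induction n)
    case 0
    have "(\<Union>A\<in>{{\<one>}, H}. A) \<lesssim> Y"
    proof (rule UN_lepoll_infinite[OF Y])
      show "{{\<one>}, H} \<lesssim> Y"
        using Y by (simp add: finite_lepoll_infinite)
      show "A \<lesssim> Y" if "A \<in> {{\<one>}, H}" for A
        using that H finite_lepoll_infinite[OF Y, of "{\<one>}"] by auto
    qed
    then show ?case
      by (simp add: G_0)
  next
    case (Suc n)
    have "ops \<lesssim> Y"
      using Y by (intro finite_lepoll_infinite) (auto simp: ops_def)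
    then show ?case
      unfolding G_Suc
      by (intro UN_lepoll_infinite[OF Y] lepoll_trans[OF image_lepoll] Times_lepoll_infinite[OF Y] Suc)
  qed
  then have "(\<Union>n. G n) \<lesssim> Y"
    using Y infinite_le_lepoll by (intro UN_lepoll_infinite) auto
  ultimately show ?thesis
    using subset_imp_lepoll lepoll_trans by blast
qed

section \<open>Prime ideals avoiding a multiplicatively closed set\<close>

text \<open>Krull's argument: an ideal that is maximal among those disjoint from \<open>F\<close> is
  prime.\<close>

lemma (in cring) exists_primeideal_disjoint:
  assumes F: "F \<subseteq> carrier R" "F \<noteq> {}" and zero: "\<zero> \<notin> F"
    and mult: "\<And>x y. \<lbrakk>x \<in> F; y \<in> F\<rbrakk> \<Longrightarrow> x \<otimes> y \<in> F"
  shows "\<exists>P. primeideal P R \<and> P \<inter> F = {}"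
proof -
  define \<I> where "\<I> = {I. ideal I R \<and> I \<inter> F = {}}"
  have "\<exists>M\<in>\<I>. \<forall>I\<in>\<I>. M \<subseteq> I \<longrightarrow> I = M"
  proof (rule subset_Zorn_nonempty)
    show "\<I> \<noteq> {}"
      using zeroideal zero by (auto simp: \<I>_def)
    fix C assume "C \<noteq> {}" and C: "subset.chain \<I> C"
    then have "subset.chain {I. ideal I R} C"
      by (auto simp: pred_on.chain_def \<I>_def)
    then have "ideal (\<Union>C) R"
      using chain_Union_is_ideal[of C] \<open>C \<noteq> {}\<close> by simp
    then show "\<Union>C \<in> \<I>"
      using C by (auto simp: pred_on.chain_def \<I>_def)
  qed
  then obtain M where M: "ideal M R" "M \<inter> F = {}"
    and max: "\<And>I. \<lbrakk>ideal I R; I \<inter> F = {}; M \<subseteq> I\<rbrakk> \<Longrightarrow> I = M"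
    by (auto simp: \<I>_def)
  interpret M: ideal M R by (rule M)
  \<comment> \<open>Otherwise \<open>M <+> PIdl a\<close> would still avoid \<open>F\<close>, and
    maximality would put \<open>a\<close> into \<open>M\<close>.\<close>
  have meets: "\<exists>m\<in>M. \<exists>x\<in>carrier R. m \<oplus> x \<otimes> a \<in> F" if a: "a \<in> carrier R" "a \<notin> M" for a
  proof (rule ccontr)
    assume neg: "\<not> ?thesis"
    have "M <+> PIdl a = M"
    proof (rule max)
      show "ideal (M <+> PIdl a) R"
        using M(1) cgenideal_ideal[OF a(1)] by (rule add_ideals)
      show "(M <+> PIdl a) \<inter> F = {}"
        using neg by (auto simp: set_add_def' cgenideal_def)
      show "M \<subseteq> M <+> PIdl a"
      proof
        fix m assume "m \<in> M"
        moreover have "m = m \<oplus> \<zero> \<otimes> a" using \<open>m \<in> M\<close> M.Icarr a by simp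
        ultimately show "m \<in> M <+> PIdl a"
          unfolding set_add_def' cgenideal_def by blast
      qed
    qed
    moreover have "a = \<zero> \<oplus> \<one> \<otimes> a" using a by simp
    then have "a \<in> M <+> PIdl a"
      unfolding set_add_def' cgenideal_def using M.zero_closed by blast
    ultimately show False using a by simp
  qed
  have "primeideal M R"
  proof (rule primeidealI[OF M(1) is_cring])
    show "carrier R \<noteq> M" using F M(2) by auto
    fix a b assume a: "a \<in> carrier R" and b: "b \<in> carrier R" and ab: "a \<otimes> b \<in> M"
    show "a \<in> M \<or> b \<in> M"
    proof (rule ccontr)
      assume "\<not> ?thesis"
      then obtain m x n y where m: "m \<in> M" "x \<in> carrier R" "m \<oplus> x \<otimes> a \<in> F"
        and n: "n \<in> M" "y \<in> carrier R" "n \<oplus> y \<otimes> b \<in> F"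
        using meets a b by metis
      \<comment> \<open>Every summand of the expansion has a factor \<open>m\<close>,
        \<open>n\<close> or \<open>a \<otimes> b\<close>, all in \<open>M\<close>.\<close>
      have "(m \<oplus> x \<otimes> a) \<otimes> (n \<oplus> y \<otimes> b)
          = m \<otimes> (n \<oplus> y \<otimes> b) \<oplus> (x \<otimes> a \<otimes> n \<oplus> x \<otimes> y \<otimes> (a \<otimes> b))"
        using m(1,2) n(1,2) a b M.Icarr by algebra
      also have "\<dots> \<in> M"
        using m(2) n(2) a b M.Icarr[OF n(1)]
        by (intro M.a_closed M.I_r_closed[OF m(1)] M.I_l_closed[OF n(1)] M.I_l_closed[OF ab])
          simp_all
      finally show False using mult[OF m(3) n(3)] M(2) by blast
    qed
  qed
  with M(2) show ?thesis by blast
qed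

section \<open>Prime ideals of a Boolean ring\<close>

context boolean_ring
begin

lemma mult_compl: "x \<in> carrier R \<Longrightarrow> x \<otimes> (\<one> \<ominus> x) = \<zero>"
  using idem[of x] by algebra

text \<open>The product of \<open>x\<close> and \<open>\<one> \<ominus> x\<close> is zero, so a
  prime contains one of them; their sum is one, so it cannot contain both. This turns non-membership
  into membership.\<close>

lemma compl_in_primeideal_iff:
  assumes "primeideal P R" "x \<in> carrier R"
  shows "\<one> \<ominus> x \<in> P \<longleftrightarrow> x \<notin> P"
proof -
  interpret P: primeideal P R by fact
  have "x \<in> P \<or> \<one> \<ominus> x \<in> P"
    using P.I_prime[of x "\<one> \<ominus> x"] mult_compl P.zero_closed assms(2) by simp
  moreover have False if "x \<in> P" "\<one> \<ominus> x \<in> P"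
  proof -
    have "\<one> = x \<oplus> (\<one> \<ominus> x)" using assms(2) by algebra
    then show False using that P.a_closed P.one_imp_carrier P.I_notcarr by metis
  qed
  ultimately show ?thesis by blast
qed

text \<open>Idempotence makes \<open>{x}\<close> itself closed under multiplication.\<close>

lemma exists_primeideal_not_containing:
  assumes "x \<in> carrier R" "x \<noteq> \<zero>"
  shows "\<exists>P. primeideal P R \<and> x \<notin> P"
  using exists_primeideal_disjoint[of "{x}"] assms idem by auto

text \<open>The Stone embedding, used to see that an infinite \<open>R\<close> has infinitely many
  primes.\<close>

lemma carrier_lepoll_Pow_Spec: "carrier R \<lesssim> Pow (Spec R)"
proof -
  have "inj_on (\<lambda>x. {P \<in> Spec R. x \<in> P}) (carrier R)"
  proof (rule inj_onI, rule ccontr)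
    fix x y assume xy: "x \<in> carrier R" "y \<in> carrier R" "x \<noteq> y"
      and eq: "{P \<in> Spec R. x \<in> P} = {P \<in> Spec R. y \<in> P}"
    from xy have "x \<ominus> y \<in> carrier R" "x \<ominus> y \<noteq> \<zero>" by simp_all
    then obtain P where P: "primeideal P R" "x \<ominus> y \<notin> P"
      using exists_primeideal_not_containing by blast
    interpret P: primeideal P R by (rule P(1))
    have "x \<in> P \<longleftrightarrow> y \<in> P"
      using eq P(1) by (auto simp: Spec_def)
    moreover have "\<not> (x \<in> P \<and> y \<in> P)"
      using P(2) by (auto simp: minus_eq)
    \<comment> \<open>The prime contains neither \<open>x\<close> nor \<open>y\<close>, hence both
      complements, whose difference is \<open>x \<ominus> y\<close> again.\<close>
    ultimately have "\<one> \<ominus> x \<in> P" "\<one> \<ominus> y \<in> P"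
      using compl_in_primeideal_iff[OF P(1)] xy by auto
    moreover have "x \<ominus> y = (\<one> \<ominus> y) \<oplus> \<ominus> (\<one> \<ominus> x)"
      using xy by algebra
    ultimately show False
      using P(2) by (metis P.a_closed P.a_inv_closed)
  qed
  then show ?thesis
    unfolding lepoll_def by blast
qed

lemma subring_separating_primes_eq_carrier:
  assumes S: "subring S R"
    and sep: "\<And>P Q. \<lbrakk>primeideal P R; primeideal Q R; P \<inter> S = Q \<inter> S\<rbrakk> \<Longrightarrow> P = Q"
  shows "S = carrier R"
proof (rule ccontr)
  assume "S \<noteq> carrier R"
  then obtain a where a: "a \<in> carrier R" "a \<notin> S"
    using subringE(1)[OF S] by blast
  note S_closed = subringE(2,3,5-7)[OF S]
  have S_carr: "s \<in> carrier R" if "s \<in> S" for s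
    using that subringE(1)[OF S] by blast
  have S_compl: "\<one> \<ominus> s \<in> S" if "s \<in> S" for s
    using that S_closed by (simp add: minus_eq)
  define F where "F = {s \<in> S. (\<one> \<ominus> s) \<otimes> a \<in> S}"
  have "\<exists>P. primeideal P R \<and> P \<inter> F = {}"
  proof (rule exists_primeideal_disjoint)
    show "F \<subseteq> carrier R" using S_carr by (auto simp: F_def)
    have "(\<one> \<ominus> \<one>) \<otimes> a = \<zero>" using a by algebra
    then have "\<one> \<in> F" using S_closed by (simp add: F_def)
    then show "F \<noteq> {}" by blast
    have "(\<one> \<ominus> \<zero>) \<otimes> a = a" using a by algebra
    then show "\<zero> \<notin> F" using a by (simp add: F_def)
    fix s t assume st: "s \<in> F" "t \<in> F"
    then have st': "s \<in> carrier R" "t \<in> carrier R"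
      using S_carr by (auto simp: F_def)
    \<comment> \<open>Both summands lie in \<open>S\<close>: the first since
      \<open>s \<in> F\<close>, the second since \<open>t \<in> F\<close> and
      \<open>s \<in> S\<close>.\<close>
    have "(\<one> \<ominus> s \<otimes> t) \<otimes> a = (\<one> \<ominus> s) \<otimes> a \<oplus> s \<otimes> ((\<one> \<ominus> t) \<otimes> a)"
      using st' a by algebra
    then show "s \<otimes> t \<in> F"
      using st S_closed by (simp add: F_def)
  qed
  then obtain P where P: "primeideal P R" and PF: "P \<inter> F = {}" by blast
  interpret P: primeideal P R by (rule P)
  \<comment> \<open>Disjointness from \<open>F\<close> is applied to the complement of
    \<open>s\<close>.\<close>
  have *: "s \<in> P" if "s \<in> S" "s \<otimes> a \<in> S" for s
  proof -
    have "\<one> \<ominus> (\<one> \<ominus> s) = s" using S_carr[OF that(1)] by algebra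
    then have "\<one> \<ominus> s \<in> F" using that S_compl by (simp add: F_def)
    then show ?thesis
      using PF compl_in_primeideal_iff[OF P S_carr[OF that(1)]] by blast
  qed
  have extend: "\<exists>Q. primeideal Q R \<and> b \<notin> Q \<and> Q \<inter> S = P \<inter> S"
    if b: "b \<in> carrier R" and ann: "\<And>s. \<lbrakk>s \<in> S; s \<otimes> b = \<zero>\<rbrakk> \<Longrightarrow> s \<in> P" for b
  proof -
    \<comment> \<open>A prime avoiding \<open>E\<close> misses \<open>b\<close>, as
      \<open>\<one> \<in> S - P\<close>, and misses all of \<open>S - P\<close>, since it absorbs
      multiples by \<open>b\<close>.\<close>
    define E where "E = (\<lambda>s. s \<otimes> b) ` (S - P)"
    have "\<one> \<in> S - P"
      using S_closed P.one_imp_carrier P.I_notcarr by blast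
    then have bE: "b \<in> E" using b by (force simp: E_def)
    have "\<exists>Q. primeideal Q R \<and> Q \<inter> E = {}"
    proof (rule exists_primeideal_disjoint)
      show "E \<subseteq> carrier R" using S_carr b by (auto simp: E_def)
      show "E \<noteq> {}" using bE by blast
      show "\<zero> \<notin> E" using ann by (force simp: E_def)
      fix x y assume "x \<in> E" "y \<in> E"
      then obtain s t where st: "s \<in> S - P" "t \<in> S - P" "x = s \<otimes> b" "y = t \<otimes> b"
        by (auto simp: E_def)
      have "x \<otimes> y = (s \<otimes> t) \<otimes> (b \<otimes> b)"
        using st S_carr b by (simp add: m_ac)
      moreover have "s \<otimes> t \<in> S - P"
        using st S_closed(4) P.I_prime[OF S_carr S_carr, of s t] by auto
      ultimately show "x \<otimes> y \<in> E"
        using idem[OF b] by (auto simp: E_def)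
    qed
    then obtain Q where Q: "primeideal Q R" and QE: "Q \<inter> E = {}" by blast
    interpret Q: primeideal Q R by (rule Q)
    have QP: "s \<in> P" if "s \<in> S" "s \<in> Q" for s
      using that QE Q.I_r_closed[OF that(2) b] by (auto simp: E_def)
    \<comment> \<open>Passing to complements reverses the inclusion of traces just shown.\<close>
    then have "s \<in> Q" if "s \<in> S" "s \<in> P" for s
      using that S_compl compl_in_primeideal_iff[OF P] compl_in_primeideal_iff[OF Q] S_carr by blast
    with QP Q QE bE show ?thesis by blast
  qed
  \<comment> \<open>If \<open>s \<otimes> a\<close> vanishes, it lies in \<open>S\<close>, so
    \<open>*\<close> applies.\<close>
  obtain Q1 where Q1: "primeideal Q1 R" "a \<notin> Q1" "Q1 \<inter> S = P \<inter> S"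
    using extend[of a] a * S_closed(1) by metis
  \<comment> \<open>Here \<open>s \<otimes> a\<close> equals \<open>s\<close>, so it lies in
    \<open>S\<close> and \<open>*\<close> applies again.\<close>
  have "s \<in> P" if "s \<in> S" "s \<otimes> (\<one> \<ominus> a) = \<zero>" for s
  proof -
    have "s \<otimes> a = s \<ominus> s \<otimes> (\<one> \<ominus> a)"
      using S_carr[OF that(1)] a by algebra
    also have "\<dots> = s" using that S_carr[OF that(1)] by algebra
    finally show ?thesis using * that by simp
  qed
  then obtain Q2 where Q2: "primeideal Q2 R" "\<one> \<ominus> a \<notin> Q2" "Q2 \<inter> S = P \<inter> S"
    using extend[of "\<one> \<ominus> a"] a by auto
  have "a \<in> Q2" using compl_in_primeideal_iff[OF Q2(1)] a Q2(2) by blast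
  moreover have "Q1 = Q2" using sep Q1 Q2 by simp
  ultimately show False using Q1(2) by simp
qed

end

theorem theorem4p5:
  fixes R :: "('a, 'b) ring_scheme"
  assumes "boolean_ring R"
    and "infinite (carrier R)"
  shows "carrier R \<lesssim> Spec R"
proof -
  interpret boolean_ring R by fact
  have inf: "infinite (Spec R)"
    using carrier_lepoll_Pow_Spec assms(2) lepoll_iff finite_Pow_iff finite_surj by metis
  \<comment> \<open>The chosen witness is meaningful only for distinct primes, so \<open>H\<close>
    leaves out the diagonal.\<close>
  define d where "d = (\<lambda>(P, Q). SOME x :: 'a. x \<in> (P - Q) \<union> (Q - P))"
  have d: "d (P, Q) \<in> (P - Q) \<union> (Q - P)" if "P \<noteq> Q" for P Q
    unfolding d_def prod.case by (rule someI_ex) (use that in blast)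
  define H where "H = d ` {(P, Q) \<in> Spec R \<times> Spec R. P \<noteq> Q}"
  have H_carr: "H \<subseteq> carrier R"
  proof
    fix x assume "x \<in> H"
    then obtain P Q where PQ: "P \<in> Spec R" "Q \<in> Spec R" "P \<noteq> Q" and x: "x = d (P, Q)"
      by (auto simp: H_def)
    have "ideal P R" "ideal Q R"
      using PQ by (simp_all add: Spec_def primeideal.axioms(1))
    moreover have "x \<in> P \<or> x \<in> Q"
      using d[OF PQ(3)] x by blast
    ultimately show "x \<in> carrier R"
      by (auto intro: ideal.Icarr)
  qed
  have "H \<lesssim> Spec R \<times> Spec R"
    unfolding H_def by (rule subset_image_lepoll) blast
  also have "Spec R \<times> Spec R \<lesssim> Spec R"
    by (rule Times_lepoll_infinite[OF inf]) simp_all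
  finally have "generate_ring R H \<lesssim> Spec R"
    by (rule generate_ring_lepoll[OF inf])
  moreover have "generate_ring R H = carrier R"
  proof (rule subring_separating_primes_eq_carrier)
    show "subring (generate_ring R H) R"
      using H_carr by (rule generate_ring_is_subring)
    fix P Q assume P: "primeideal P R" and Q: "primeideal Q R"
      and eq: "P \<inter> generate_ring R H = Q \<inter> generate_ring R H"
    show "P = Q"
    proof (rule ccontr)
      assume "P \<noteq> Q"
      then have "d (P, Q) \<in> H"
        using P Q unfolding H_def Spec_def by blast
      then have "d (P, Q) \<in> generate_ring R H"
        by (rule generate_ring.incl)
      then show False using d[OF \<open>P \<noteq> Q\<close>] eq by blast
    qed
  qed
  ultimately show ?thesis by simp
qed

end
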